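(* Consider a linear LC network with $k$ inductors and $p$ capacitors, $b=k+p$, whose Birkhoffian on the $m$-dimensional configuration space $M_{\mathfrak c}$ has, in the coordinates $q=(q^1,\dots,q^m)$, the components $$\mathfrak{Q}_j(q,\dot q,\ddot q)=\sum_{a=1}^{k}\sum_{i=1}^{m}\mathrm{L}_a\,\mathcal N^{a}_j\mathcal N^{a}_i\,\ddot q^i+\sum_{\alpha=k+1}^{b}\sum_{i=1}^{m}\frac{\mathcal N^{\alpha}_j\mathcal N^{\alpha}_i}{\mathrm{C}_{\alpha-k}}\,q^i+(\mathrm{const})_j,\qquad j=1,\dots,m,$$ where $\mathrm{const}\in\mathbb R^m$ is a constant vector related to the initial data of the network. Assume that $$\det\Big[\sum_{a=1}^{k}\mathrm L_a\mathcal N^a_j\mathcal N^a_i\Big]_{j,i=1,\dots,m}\neq0,\qquad \det\Big[\sum_{\alpha=k+1}^{b}\frac{\mathcal N^\alpha_j\mathcal N^\alpha_i}{\mathrm C_{\alpha-k}}\Big]_{j,i=1,\dots,m}\neq 0 .$$ Let $(q_e,0)$ be an equilibrium point of the network. Then $q=q_e$ satisfies the system $$\sum_{\alpha=k+1}^{b}\sum_{i=1}^{m}\frac{\mathcal N^\alpha_j\mathcal N^\alpha_i}{\mathrm C_{\alpha-k}}\,q^i+(\mathrm{const})_j=0,\qquad j=1,\dots,m .$$ To each vector $\mathrm{const}$ there corresponds a unique equilibrium point. If moreover $$\mathrm L_a>0\ \ \text{for all } a=1,\dots,k,\qquad \mathrm C_\alpha>0\ \ \text{for all }\alpha=1,\dots,p,$$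 then the equilibrium point is a stable center, and the motion of the system is periodic.
   Context: Network. An LC network is given by an oriented connected planar graph with $b$ branches, $n+1$ nodes and $m=b-n>0$ independent loops. Each branch carries exactly one device: branches $1,\dots,k$ are inductors and branches $k+1,\dots,b$ are capacitors, $b=k+p$. The devices are linear: for inductor $a$, $v_{(a)}=\mathrm L_a\, d\mathrm i_{(a)}/dt$; for capacitor $\alpha$, $v_\alpha=\mathrm q_\alpha/\mathrm C_\alpha$ with $\mathrm q_\alpha$ the charge and $\mathrm i_\alpha=d\mathrm q_\alpha/dt$; here $\mathrm L_a\ne0$, $\mathrm C_\alpha\neq0$ are constants. Configuration space. Let $B$ be the $b\times n$ incidence matrix of the graph (one reference node removed; entries $0,\pm1$; rank $n$), so that Kirchhoff's current law is $B^T\mathrm i=0$. For a constant vector $\mathfrak c\in\mathbb R^n$ (corresponding to initial values of certain state variables of the circuit), $M_{\mathfrak c}=\{x\in\mathbb R^b: B^Tx=\mathfrak c\}$, where $\mathrm i=\dot x$. It is an $m$-dimensional affine space, parameterized by coordinates $q\in\mathbb R^m$ through $x=\mathcal Nq+\mathcal K$, where $\mathcal N=(\mathcal N^l_j)$, $l=1,\dots,b$, $j=1,\dots,m$, is a constant $b\times m$ matrix (its columns form a basis of $\ker B^T$) and $\mathcal K\in\mathbb R^b$ is a constant vector. Row $l$ of $\mathcal N$ corresponds to branch $l$. The Birkhoffian is the 1-form $\sum_j\mathfrak Q_j\,dq^j$; its components are obtained by applying $\mathcal N^T$ to the vector of voltage drops (Kirchhoff's voltage law). Dynamics. The motions $q(t)$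 are the solutions of $\mathfrak Q_j(q,\dot q,\ddot q)=0$, $j=1,\dots,m$; the state is $(q,\dot q)\in TM_{\mathfrak c}\cong\mathbb R^m\times\mathbb R^m$. Since the first determinant is nonzero, the system can be solved for $\ddot q$ and defines a unique second order vector field $Y$ (the Birkhoffian vector field) on $TM_{\mathfrak c}$. An equilibrium point is a point $(q_e,0)$ with $\mathfrak Q_j(q_e,0,0)=0$ for all $j$. It is stable if for every open neighborhood $\Omega$ of $(q_e,0)$ there is a neighborhood $\Omega_1\subset\Omega$ of $(q_e,0)$ such that every motion $(q(t),\dot q(t))$ starting at a point of $\Omega_1$ remains in $\Omega$. A Liapunov function near $(q_e,0)$ is a $C^1$ function $V$ with $V(q_e,0)=0$, $V>0$ on $\Omega\setminus\{(q_e,0)\}$ and $dV(Y)\le0$ on $\Omega$, for some open neighborhood $\Omega$ of $(q_e,0)$. The equilibrium is called a center when there is such a $V$ with $dV(Y)=0$ on $\Omega$ (so that motions stay on the closed level sets of $V$ surrounding the equilibrium).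
   Formalization: "The motion of the system is periodic" fails for m ≥ 2 (e.g. two uncoupled LC loops with frequencies 1 and √2); proved instead: every motion is a superposition of m harmonic modes, periodic exactly when the frequencies of its excited modes have rational ratios. *)

theory Defs
  imports "Graph_Theory.Digraph_Component" "HOL-Analysis.Analysis"
begin

section \<open>Networks\<close>

text \<open>
  A plane drawing of a multigraph without self-loops: nodes are distinct points and branches are
  arcs that meet each other and the nodes only at their end points. The predicate
  \<open>kuratowski_planar\<close> of the graph library is not usable here, since it only looks for
  bidirected obstructions and therefore holds of every oriented graph.
\<close>

definition planar_digraph :: "('v, 'e) pre_digraph \<Rightarrow> bool" where
  "planar_digraph G \<longleftrightarrow>
     (\<exists>(pos :: 'v \<Rightarrow> complex) (\<gamma> :: 'e \<Rightarrow> real \<Rightarrow> complex).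
        inj_on pos (verts G) \<and>
        (\<forall>e\<in>arcs G. arc (\<gamma> e) \<and> pathstart (\<gamma> e) = pos (tail G e) \<and> pathfinish (\<gamma> e) = pos (head G e)
                   \<and> \<gamma> e ` {0<..<1} \<inter> pos ` verts G = {}) \<and>
        (\<forall>e\<in>arcs G. \<forall>f\<in>arcs G. e \<noteq> f \<longrightarrow> \<gamma> e ` {0<..<1} \<inter> path_image (\<gamma> f) = {}))"

text \<open>
  The \<open>n + 1\<close> nodes are the elements of \<open>'n option\<close>, where \<open>None\<close> is the reference node whose
  column is removed from the incidence matrix.
\<close>

definition incidence_matrix :: "('n::finite option, 'e::finite) pre_digraph \<Rightarrow> real^'n^'e" where
  "incidence_matrix G = (\<chi> e i. of_bool (tail G e = Some i) - of_bool (head G e = Some i))"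

definition config_space ::
    "('n::finite option, 'e::finite) pre_digraph \<Rightarrow> real^'n \<Rightarrow> (real^'e) set" where
  "config_space G \<cc> = {x. transpose (incidence_matrix G) *v x = \<cc>}"

text \<open>
  Branches are the elements of \<open>'l + 'c\<close>: \<open>Inl a\<close> carries the inductor \<open>a\<close> and \<open>Inr \<alpha>\<close> the
  capacitor \<open>\<alpha>\<close>, so \<open>C $ \<alpha>\<close> belongs to row \<open>Inr \<alpha>\<close> of \<open>\<N>\<close>. The affine map
  \<open>q \<mapsto> \<N> q + \<K>\<close> parameterizes \<open>config_space G \<cc>\<close>.
\<close>

definition lc_network ::
    "('n::finite option, 'l::finite + 'c::finite) pre_digraph \<Rightarrow> real^'l \<Rightarrow> real^'c \<Rightarrow>
     real^'n \<Rightarrow> real^'m^('l + 'c) \<Rightarrow> real^('l + 'c) \<Rightarrow> bool" where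
  "lc_network G L C \<cc> \<N> \<K> \<longleftrightarrow>
     verts G = UNIV \<and> arcs G = UNIV \<and> fin_digraph G \<and> loopfree_digraph G \<and>
     Digraph_Component.connected G \<and> planar_digraph G \<and>
     CARD('l + 'c) = CARD('n) + CARD('m) \<and>
     (\<forall>a. L $ a \<noteq> 0) \<and> (\<forall>\<alpha>. C $ \<alpha> \<noteq> 0) \<and>
     inj (\<lambda>j. column j \<N>) \<and> independent (columns \<N>) \<and>
     span (columns \<N>) = {x. transpose (incidence_matrix G) *v x = 0} \<and>
     \<K> \<in> config_space G \<cc>"


section \<open>The Birkhoffian\<close>

text \<open>
  Along \<open>x = \<N> q + \<K>\<close> the currents are \<open>x' = \<N> q'\<close>, so the drop at an inductor is
  \<open>L (\<N> q'')\<close>. The charge of a capacitor has derivative \<open>x'\<close>, hence equals \<open>x + \<kappa>\<close> with a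
  constant \<open>\<kappa>\<close>.
\<close>

definition voltage_drop ::
    "real^'l \<Rightarrow> real^'c \<Rightarrow> real^'m^('l::finite + 'c::finite) \<Rightarrow> real^('l + 'c) \<Rightarrow> real^'c \<Rightarrow>
     real^'m \<Rightarrow> real^'m \<Rightarrow> real^'m \<Rightarrow> real^('l + 'c)" where
  "voltage_drop L C \<N> \<K> \<kappa> q q' q'' =
     (\<chi> l. case l of Inl a \<Rightarrow> L $ a * (\<N> *v q'') $ Inl a
                   | Inr \<alpha> \<Rightarrow> ((\<N> *v q + \<K>) $ Inr \<alpha> + \<kappa> $ \<alpha>) / C $ \<alpha>)"

definition birkhoffian ::
    "real^'l \<Rightarrow> real^'c \<Rightarrow> real^'m^('l::finite + 'c::finite) \<Rightarrow> real^('l + 'c) \<Rightarrow> real^'c \<Rightarrow>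
     real^'m \<Rightarrow> real^'m \<Rightarrow> real^'m \<Rightarrow> real^'m" where
  "birkhoffian L C \<N> \<K> \<kappa> q q' q'' = transpose \<N> *v voltage_drop L C \<N> \<K> \<kappa> q q' q''"

definition lc_components ::
    "real^'l \<Rightarrow> real^'c \<Rightarrow> real^'m^('l::finite + 'c::finite) \<Rightarrow> real^'m \<Rightarrow>
     real^'m \<Rightarrow> real^'m \<Rightarrow> real^'m \<Rightarrow> real^'m" where
  "lc_components L C \<N> const q q' q'' =
     (\<chi> j. (\<Sum>a\<in>UNIV. \<Sum>i\<in>UNIV. L $ a * \<N> $ Inl a $ j * \<N> $ Inl a $ i * q'' $ i)
         + (\<Sum>\<alpha>\<in>UNIV. \<Sum>i\<in>UNIV. \<N> $ Inr \<alpha> $ j * \<N> $ Inr \<alpha> $ i / C $ \<alpha> * q $ i)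
         + const $ j)"

lemma birkhoffian_eq_lc_components:
  "birkhoffian L C \<N> \<K> \<kappa> =
     lc_components L C \<N> (\<chi> j. \<Sum>\<alpha>\<in>UNIV. \<N> $ Inr \<alpha> $ j * (\<K> $ Inr \<alpha> + \<kappa> $ \<alpha>) / C $ \<alpha>)"
  by (intro ext)
     (simp add: birkhoffian_def lc_components_def voltage_drop_def vec_eq_iff transpose_def
        matrix_vector_mult_def UNIV_Plus_UNIV[symmetric] sum.Plus del: UNIV_Plus_UNIV,
      simp add: sum_distrib_left sum_distrib_right sum_divide_distrib sum.distrib add_divide_distrib
        algebra_simps)


section \<open>Dynamics\<close>

text \<open>
  The following notions apply to any \<open>Q q q' q''\<close>; the state space \<open>TM\<close> is the product
  \<open>(real^'m) \<times> (real^'m)\<close>. The time domain \<open>I\<close> of a motion need not be open.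
\<close>

definition motion_on ::
    "(real^'m \<Rightarrow> real^'m \<Rightarrow> real^'m \<Rightarrow> real^'m) \<Rightarrow> real set \<Rightarrow>
     (real \<Rightarrow> real^'m) \<Rightarrow> (real \<Rightarrow> real^'m) \<Rightarrow> bool" where
  "motion_on Q I q q' \<longleftrightarrow>
     (\<forall>t\<in>I. (q has_vector_derivative q' t) (at t within I) \<and>
            (\<exists>a. (q' has_vector_derivative a) (at t within I) \<and> Q (q t) (q' t) a = 0))"

definition birkhoff_field ::
    "(real^'m \<Rightarrow> real^'m \<Rightarrow> real^'m \<Rightarrow> real^'m) \<Rightarrow> (real^'m) \<times> (real^'m) \<Rightarrow> (real^'m) \<times> (real^'m)" where
  "birkhoff_field Q z = (snd z, THE a. Q (fst z) (snd z) a = 0)"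

definition equilibrium_point ::
    "(real^'m \<Rightarrow> real^'m \<Rightarrow> real^'m \<Rightarrow> real^'m) \<Rightarrow> (real^'m) \<times> (real^'m) \<Rightarrow> bool" where
  "equilibrium_point Q z \<longleftrightarrow> snd z = 0 \<and> Q (fst z) 0 0 = 0"

definition stable_equilibrium ::
    "(real^'m \<Rightarrow> real^'m \<Rightarrow> real^'m \<Rightarrow> real^'m) \<Rightarrow> (real^'m) \<times> (real^'m) \<Rightarrow> bool" where
  "stable_equilibrium Q z \<longleftrightarrow>
     (\<forall>\<Omega>. open \<Omega> \<and> z \<in> \<Omega> \<longrightarrow>
        (\<exists>\<Omega>\<^sub>1\<subseteq>\<Omega>. open \<Omega>\<^sub>1 \<and> z \<in> \<Omega>\<^sub>1 \<and>
           (\<forall>I q q'. is_interval I \<and> 0 \<in> I \<and> I \<subseteq> {0..} \<and> motion_on Q I q q' \<and> (q 0, q' 0) \<in> \<Omega>\<^sub>1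
              \<longrightarrow> (\<forall>t\<in>I. (q t, q' t) \<in> \<Omega>))))"

definition C1_on :: "('a::real_normed_vector \<Rightarrow> real) \<Rightarrow> 'a set \<Rightarrow> bool" where
  "C1_on V \<Omega> \<longleftrightarrow>
     (\<exists>D. (\<forall>z\<in>\<Omega>. (V has_derivative blinfun_apply (D z)) (at z)) \<and> continuous_on \<Omega> D)"

definition liapunov_function ::
    "(real^'m \<Rightarrow> real^'m \<Rightarrow> real^'m \<Rightarrow> real^'m) \<Rightarrow> (real^'m) \<times> (real^'m) \<Rightarrow>
     ((real^'m) \<times> (real^'m) \<Rightarrow> real) \<Rightarrow> ((real^'m) \<times> (real^'m)) set \<Rightarrow> bool" where
  "liapunov_function Q z V \<Omega> \<longleftrightarrow>
     open \<Omega> \<and> z \<in> \<Omega> \<and> C1_on V \<Omega> \<and> V z = 0 \<and> (\<forall>y\<in>\<Omega> - {z}. V y > 0) \<and>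
     (\<forall>y\<in>\<Omega>. frechet_derivative V (at y) (birkhoff_field Q y) \<le> 0)"

definition center ::
    "(real^'m \<Rightarrow> real^'m \<Rightarrow> real^'m \<Rightarrow> real^'m) \<Rightarrow> (real^'m) \<times> (real^'m) \<Rightarrow> bool" where
  "center Q z \<longleftrightarrow>
     (\<exists>V \<Omega>. liapunov_function Q z V \<Omega> \<and>
            (\<forall>y\<in>\<Omega>. frechet_derivative V (at y) (birkhoff_field Q y) = 0))"

definition periodic :: "(real \<Rightarrow> 'a) \<Rightarrow> bool" where
  "periodic f \<longleftrightarrow> (\<exists>T>0. \<forall>t. f (t + T) = f t)"

text \<open>
  The superposition of the harmonic oscillations with frequency \<open>\<omega> r\<close> along \<open>w r\<close> about \<open>q\<^sub>e\<close>.
  If only one mode is excited, or more generally if the frequencies of the excited modes are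
  commensurable, this is a periodic function of \<open>t\<close>; otherwise it is only quasi-periodic.
\<close>

definition superposition ::
    "real^'m \<Rightarrow> ('m \<Rightarrow> real) \<Rightarrow> ('m \<Rightarrow> real^'m) \<Rightarrow> ('m \<Rightarrow> real) \<Rightarrow> ('m \<Rightarrow> real) \<Rightarrow> real \<Rightarrow> real^'m" where
  "superposition q\<^sub>e \<omega> w A B t =
     q\<^sub>e + (\<Sum>r\<in>UNIV. (A r * cos (\<omega> r * t) + B r * sin (\<omega> r * t)) *\<^sub>R w r)"

definition excited :: "('m \<Rightarrow> real) \<Rightarrow> ('m \<Rightarrow> real) \<Rightarrow> 'm set" where
  "excited A B = {r. A r \<noteq> 0 \<or> B r \<noteq> 0}"

end

theory Submission
  imports Defs
begin

text \<open>
  Up to the translation by \<open>q\<^sub>e\<close> the equations of motion read \<open>M q'' + K (q - q\<^sub>e) = 0\<close> with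
  weighted Gram matrices \<open>M\<close> and \<open>K\<close> of the rows of \<open>\<N>\<close>; they are positive definite when the
  weights are positive and the determinants do not vanish. The energy
  \<open>(q' \<bullet> M q' + (q - q\<^sub>e) \<bullet> K (q - q\<^sub>e)) / 2\<close> is then a positive definite first integral, which
  gives stability and the center. Simultaneous diagonalization of \<open>M\<close> and \<open>K\<close> decouples the system
  into harmonic oscillators, and a period of a superposition is a common period of the excited ones.
\<close>

section \<open>Quadratic forms and harmonic oscillations\<close>

text \<open>For small \<open>t\<close> with the sign of \<open>b\<close> the linear term dominates
  the quadratic one. This serves as the first-variation argument at a maximizer.\<close>

lemma quadratic_nonpos_imp_linear_coeff_zero:
  fixes b c :: real
  assumes "\<And>t. 2 * t * b + t\<^sup>2 * c \<le> 0"
  shows "b = 0"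
proof (rule ccontr)
  assume "b \<noteq> 0"
  \<comment> \<open>Small enough that \<open>2 + e * c\<close> stays positive at the test point
    \<open>t = e * b\<close>.\<close>
  define e where "e = 1 / (1 + \<bar>c\<bar>)"
  have e: "e > 0" and ec: "e * \<bar>c\<bar> < 1"
    by (simp_all add: e_def field_simps)
  have "2 * (e * b) * b + (e * b)\<^sup>2 * c \<le> 0"
    using assms .
  moreover have "2 * (e * b) * b + (e * b)\<^sup>2 * c = e * b\<^sup>2 * (2 + e * c)"
    by (simp add: power2_eq_square algebra_simps)
  moreover have "e * c \<ge> - (e * \<bar>c\<bar>)"
    using e by (metis abs_ge_minus_self abs_mult abs_of_pos minus_le_iff)
  ultimately show False
    using e ec \<open>b \<noteq> 0\<close> by (smt (verit) mult_pos_pos zero_less_power2)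
qed

text \<open>The form attains a positive minimum on the compact unit sphere, and homogeneity of
  degree two carries the bound to all vectors.\<close>

lemma pos_def_lower_bound:
  fixes A :: "real^'m^'m"
  assumes "\<And>x. x \<noteq> 0 \<Longrightarrow> x \<bullet> (A *v x) > 0"
  obtains c where "c > 0" "\<And>x. c * (norm x)\<^sup>2 \<le> x \<bullet> (A *v x)"
proof -
  have "compact (sphere (0::real^'m) 1)" by simp
  moreover have "sphere (0::real^'m) 1 \<noteq> {}" by simp
  moreover have "continuous_on (sphere 0 1) (\<lambda>x. x \<bullet> (A *v x))"
    by (intro continuous_intros)
  ultimately obtain x0 where x0: "x0 \<in> sphere 0 1" 
    "\<And>y. y \<in> sphere 0 1 \<Longrightarrow> x0 \<bullet> (A *v x0) \<le> y \<bullet> (A *v y)"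
    using continuous_attains_inf[of "sphere 0 1" "\<lambda>x. x \<bullet> (A *v x)"] by blast
  show ?thesis
  proof
    show "x0 \<bullet> (A *v x0) > 0"
      using x0(1) by (intro assms) auto
    fix x :: "real^'m"
    show "(x0 \<bullet> (A *v x0)) * (norm x)\<^sup>2 \<le> x \<bullet> (A *v x)"
    proof (cases "x = 0")
      case False
      define u where "u = x /\<^sub>R norm x"
      have x: "x = norm x *\<^sub>R u" and "u \<in> sphere 0 1"
        using False by (simp_all add: u_def)
      then have "x0 \<bullet> (A *v x0) \<le> u \<bullet> (A *v u)"
        using x0(2) by blast
      moreover have "x \<bullet> (A *v x) = (norm x)\<^sup>2 * (u \<bullet> (A *v u))"
        by (subst (1 2) x) (simp add: matrix_vector_mult_scaleR power2_eq_square)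
      ultimately show ?thesis
        by (simp add: mult.commute[of _ "(norm x)\<^sup>2"] mult_left_mono)
    qed simp
  qed
qed

section \<open>Scalar oscillators and their periods\<close>

text \<open>Rotating the phase point \<open>(u, v / \<omega>)\<close> back by the angle
  \<open>\<omega> * t\<close> freezes it, so both rotated coordinates are constants \<open>a\<close>
  and \<open>b\<close>; rotating forward again recovers \<open>u\<close>.\<close>

lemma harmonic_oscillator_unique:
  fixes u v :: "real \<Rightarrow> real"
  assumes I: "is_interval I" and \<omega>: "\<omega> \<noteq> 0"
    and u: "\<And>t. t \<in> I \<Longrightarrow> (u has_vector_derivative v t) (at t within I)"
    and v: "\<And>t. t \<in> I \<Longrightarrow> (v has_vector_derivative - \<omega>\<^sup>2 * u t) (at t within I)"
  shows "\<exists>a b. \<forall>t\<in>I. u t = a * cos (\<omega> * t) + b * sin (\<omega> * t)"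
proof -
  have conv: "convex I" using I by (simp add: is_interval_convex_1)
  note [derivative_intros] = u[folded has_real_derivative_iff_has_vector_derivative]
    v[folded has_real_derivative_iff_has_vector_derivative]
  have "((\<lambda>t. u t * cos (\<omega> * t) - v t / \<omega> * sin (\<omega> * t)) has_real_derivative 0) (at t within I)"
    if "t \<in> I" for t
    using \<omega> that by (auto intro!: derivative_eq_intros simp: field_simps power2_eq_square)
  from has_field_derivative_zero_constant[OF conv this]
  obtain a where a: "\<And>t. t \<in> I \<Longrightarrow> u t * cos (\<omega> * t) - v t / \<omega> * sin (\<omega> * t) = a" by blast
  have "((\<lambda>t. u t * sin (\<omega> * t) + v t / \<omega> * cos (\<omega> * t)) has_real_derivative 0) (at t within I)"
    if "t \<in> I" for t
    using \<omega> that by (auto intro!: derivative_eq_intros simp: field_simps power2_eq_square)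
  from has_field_derivative_zero_constant[OF conv this]
  obtain b where b: "\<And>t. t \<in> I \<Longrightarrow> u t * sin (\<omega> * t) + v t / \<omega> * cos (\<omega> * t) = b" by blast
  have "u t = a * cos (\<omega> * t) + b * sin (\<omega> * t)" if "t \<in> I" for t
  proof -
    have "a * cos (\<omega> * t) + b * sin (\<omega> * t) = u t * ((sin (\<omega> * t))\<^sup>2 + (cos (\<omega> * t))\<^sup>2)"
      by (simp only: a[OF that, symmetric] b[OF that, symmetric])
        (simp add: algebra_simps power2_eq_square del: sin_cos_squared_add sin_cos_squared_add2
          sin_cos_squared_add3)
    then show ?thesis by simp
  qed
  then show ?thesis by blast
qed

text \<open>The product of the denominators works. It provides a common period for finitely many
  commensurable oscillations.\<close>

lemma finite_Rats_common_denominator: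
  fixes S :: "real set"
  assumes "finite S" "S \<subseteq> \<rat>"
  shows "\<exists>d::nat. d > 0 \<and> (\<forall>x\<in>S. of_nat d * x \<in> \<int>)"
  using assms
proof (induction S rule: finite_induct)
  case (insert x S)
  then obtain d :: nat where d: "d > 0" "\<forall>y\<in>S. of_nat d * y \<in> \<int>" by auto
  from insert.prems have "x \<in> \<rat>" by simp
  then obtain p q where pq: "q > 0" "x = of_int p / of_int q"
    by (metis Rats_cases')
  define e where "e = nat q"
  have e: "e > 0" "of_nat e * x = of_int p"
    using pq by (auto simp: e_def)
  have "of_nat (d * e) * y \<in> \<int>" if "y \<in> insert x S" for y
  proof (cases "y = x")
    case True
    have "of_nat (d * e) * y = of_nat d * of_int p"
      by (simp only: True of_nat_mult mult.assoc e)
    then show ?thesis by (simp only: Ints_mult Ints_of_nat Ints_of_int)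
  next
    case False
    then have "of_nat d * y \<in> \<int>" using d that by auto
    then have "of_nat e * (of_nat d * y) \<in> \<int>" by (rule Ints_mult[OF Ints_of_nat])
    then show ?thesis by (simp only: of_nat_mult mult_ac)
  qed
  moreover have "d * e > 0" using d e by simp
  ultimately show ?case by blast
qed auto

text \<open>Comparing the two sides at the phases 0 and \<open>pi / 2\<close> gives two linear
  equations for \<open>c\<close> and \<open>s\<close>, whose determinant is
  \<open>a\<^sup>2 + b\<^sup>2\<close> up to sign. Hence
  \<open>cos (\<omega> * T) = 1\<close>.\<close>

lemma harmonic_period:
  fixes a b \<omega> T :: real
  assumes per: "\<And>t. a * cos (\<omega> * (t + T)) + b * sin (\<omega> * (t + T)) = a * cos (\<omega> * t) + b * sin (\<omega> * t)"
    and nz: "a \<noteq> 0 \<or> b \<noteq> 0" and \<omega>: "\<omega> \<noteq> 0"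
  obtains n :: int where "\<omega> * T = of_int n * 2 * pi"
proof -
  define c s where "c = cos (\<omega> * T) - 1" and "s = sin (\<omega> * T)"
  have 1: "a * c + b * s = 0"
    using per[of 0] by (simp add: c_def s_def algebra_simps)
  have "\<omega> * (pi / 2 / \<omega>) = pi / 2" "\<omega> * (pi / 2 / \<omega> + T) = pi / 2 + \<omega> * T"
    using \<omega> by (simp_all add: field_simps)
  then have 2: "b * c - a * s = 0"
    using per[of "pi / 2 / \<omega>"]
    by (simp only: cos_add sin_add cos_pi_half sin_pi_half) (simp add: c_def s_def algebra_simps)
  \<comment> \<open>The two-square identity takes the place of inverting the linear system.\<close>
  have "(a\<^sup>2 + b\<^sup>2) * (c\<^sup>2 + s\<^sup>2) = (a * c + b * s)\<^sup>2 + (b * c - a * s)\<^sup>2"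
    by (simp add: power2_eq_square algebra_simps)
  then have "(a\<^sup>2 + b\<^sup>2) * (c\<^sup>2 + s\<^sup>2) = 0"
    by (simp add: 1 2)
  then have "c = 0"
    using nz by (auto simp: sum_power2_eq_zero_iff)
  then show ?thesis
    using that by (auto simp: c_def cos_one_2pi_int)
qed

lemma matrix_inner_symmetric:
  fixes A :: "real^'m^'m"
  assumes "transpose A = A"
  shows "(A *v x) \<bullet> y = x \<bullet> (A *v y)"
  using dot_lmul_matrix[of x A y] vector_transpose_matrix[of x A] assms by simp

section \<open>Simultaneous diagonalization\<close>

text \<open>In the network \<open>M\<close> is the inductive Gram matrix and \<open>K\<close> the
  capacitive one.\<close>

locale oscillator =
  fixes M K :: "real^'m::finite^'m"
  assumes M_sym: "transpose M = M" and K_sym: "transpose K = K"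
    and M_pos: "\<And>x. x \<noteq> 0 \<Longrightarrow> x \<bullet> (M *v x) > 0"
    and K_pos: "\<And>x. x \<noteq> 0 \<Longrightarrow> x \<bullet> (K *v x) > 0"
begin

lemmas M_inner = matrix_inner_symmetric[OF M_sym]
lemmas K_inner = matrix_inner_symmetric[OF K_sym]

text \<open>An \<open>M\<close>-orthonormal set of eigenvectors of the pencil
  \<open>K - \<nu> M\<close>. It is a set without indexing so that an induction can insert one mode
  at a time.\<close>

definition normal_modes :: "(real^'m) set \<Rightarrow> bool" where
  "normal_modes W \<longleftrightarrow> finite W \<and> (\<forall>u\<in>W. \<forall>v\<in>W. u \<bullet> (M *v v) = of_bool (u = v)) \<and>
     (\<forall>u\<in>W. \<exists>\<nu>>0. K *v u = \<nu> *\<^sub>R (M *v u))"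

lemma normal_modes_inner_sum:
  assumes "normal_modes W" "v \<in> W"
  shows "(\<Sum>u\<in>W. f u *\<^sub>R u) \<bullet> (M *v v) = f v"
proof -
  have "(\<Sum>u\<in>W. f u *\<^sub>R u) \<bullet> (M *v v) = (\<Sum>u\<in>W. f u * of_bool (u = v))"
    using assms by (auto simp: inner_sum_left normal_modes_def intro!: sum.cong)
  also have "\<dots> = f v"
    using assms by (simp add: normal_modes_def if_distrib cong: if_cong)
  finally show ?thesis .
qed

text \<open>
  The new mode maximizes the Rayleigh quotient on the \<open>M\<close>-orthogonal complement \<open>S\<close> of the given
  modes. With \<open>D = K - \<nu> M\<close>, the first variation shows that \<open>D x\<close> is orthogonal to \<open>S\<close>, and since the
  given modes are eigenvectors \<open>D x\<close> is also orthogonal to them, hence zero.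
\<close>

lemma normal_modes_extend:
  assumes W: "normal_modes W" and card: "card W < CARD('m)"
  shows "\<exists>x. x \<notin> W \<and> normal_modes (insert x W)"
proof -
  have fin: "finite W" using W by (simp add: normal_modes_def)
  define S where "S = {x. \<forall>v\<in>W. x \<bullet> (M *v v) = 0}"
  \<comment> \<open>\<open>P\<close> is the \<open>M\<close>-orthogonal projection onto the span of
    \<open>W\<close>, so \<open>y - P y\<close> lies in \<open>S\<close>.\<close>
  define P where "P y = (\<Sum>u\<in>W. (y \<bullet> (M *v u)) *\<^sub>R u)" for y
  have PS: "y - P y \<in> S" for y
    using normal_modes_inner_sum[OF W] by (simp add: S_def P_def inner_diff_left)
  have S_sub: "x + t *\<^sub>R y \<in> S" if "x \<in> S" "y \<in> S" for x y t
    using that by (simp add: S_def inner_add_left)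
  \<comment> \<open>Otherwise every vector equals its projection, and fewer than
    \<open>CARD('m)\<close> vectors span the space.\<close>
  have "\<exists>y\<in>S. y \<noteq> 0"
  proof (rule ccontr)
    assume "\<not> ?thesis"
    then have "y = P y" for y using PS[of y] by auto
    then have "y \<in> span W" for y
    proof -
      have "P y \<in> span W" by (simp add: P_def span_base span_scale span_sum)
      then show ?thesis using \<open>y = P y\<close> by simp
    qed
    then have "span W = UNIV" by auto
    then have "dim (UNIV :: (real^'m) set) \<le> card W"
      by (metis dim_le_card' dim_span fin)
    then show False using card by simp
  qed
  then obtain y0 where y0: "y0 \<in> S" "y0 \<noteq> 0" by auto
  have M_scale: "(r *\<^sub>R y) \<bullet> (A *v (r *\<^sub>R y)) = r\<^sup>2 * (y \<bullet> (A *v y))" for r y and A :: "real^'m^'m"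
    by (simp add: matrix_vector_mult_scaleR power2_eq_square)
  \<comment> \<open>On the \<open>M\<close>-unit sphere of \<open>S\<close> the Rayleigh quotient is
    the form of \<open>K\<close> alone, and the domain is compact.\<close>
  define Z where "Z = {x\<in>S. x \<bullet> (M *v x) = 1}"
  have normalize: "(1 / sqrt (y \<bullet> (M *v y))) *\<^sub>R y \<in> Z" if "y \<in> S" "y \<noteq> 0" for y
    using that M_pos[of y] unfolding Z_def
    by (simp add: M_scale power_divide del: inner_scaleR_left inner_scaleR_right) (simp add: S_def)
  have "compact Z"
  proof (rule compact_eq_bounded_closed[THEN iffD2], rule conjI)
    obtain c where c: "c > 0" "\<And>x. c * (norm x)\<^sup>2 \<le> x \<bullet> (M *v x)"
      using pos_def_lower_bound M_pos by blast
    show "bounded Z"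
    proof (rule boundedI)
      fix x assume "x \<in> Z"
      then have "(norm x)\<^sup>2 \<le> 1 / c"
        using c(2)[of x] c(1) by (simp add: Z_def field_simps)
      then show "norm x \<le> sqrt (1 / c)"
        by (rule real_le_rsqrt)
    qed
    have "Z = (\<Inter>v\<in>W. {x. x \<bullet> (M *v v) = 0}) \<inter> {x. x \<bullet> (M *v x) = 1}"
      by (auto simp: Z_def S_def)
    moreover have "closed {x. x \<bullet> (M *v v) = 0}" for v
      by (intro closed_Collect_eq continuous_intros)
    moreover have "closed {x. x \<bullet> (M *v x) = 1}"
      by (intro closed_Collect_eq continuous_intros)
    ultimately show "closed Z" by auto
  qed
  moreover have "Z \<noteq> {}" using normalize y0 by blast
  moreover have "continuous_on Z (\<lambda>x. x \<bullet> (K *v x))" by (intro continuous_intros)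
  ultimately obtain x where x: "x \<in> Z" and max: "\<And>y. y \<in> Z \<Longrightarrow> y \<bullet> (K *v y) \<le> x \<bullet> (K *v x)"
    using continuous_attains_sup[of Z "\<lambda>x. x \<bullet> (K *v x)"] by blast
  define \<nu> where "\<nu> = x \<bullet> (K *v x)"
  have xS: "x \<in> S" and xM: "x \<bullet> (M *v x) = 1" using x by (auto simp: Z_def)
  have "x \<noteq> 0" using xM by auto
  then have "\<nu> > 0" using K_pos by (simp add: \<nu>_def)
  define D where "D y = K *v y - \<nu> *\<^sub>R (M *v y)" for y
  have D_inner: "D u \<bullet> y = u \<bullet> D y" for u y
    by (simp add: D_def inner_diff_left inner_diff_right M_inner K_inner)
  have D_add: "D (u + t *\<^sub>R y) = D u + t *\<^sub>R D y" for u t y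
    by (simp add: D_def algebra_simps matrix_vector_mult_scaleR matrix_vector_right_distrib)
  \<comment> \<open>Rescaling into \<open>Z\<close> turns maximality at \<open>x\<close> into a sign
    condition for \<open>D\<close> on all of \<open>S\<close>, with the value 0 attained at
    \<open>x\<close>.\<close>
  have nonpos: "y \<bullet> D y \<le> 0" if "y \<in> S" for y
  proof (cases "y = 0")
    case False
    have "((1 / sqrt (y \<bullet> (M *v y))) *\<^sub>R y) \<bullet> (K *v ((1 / sqrt (y \<bullet> (M *v y))) *\<^sub>R y)) \<le> \<nu>"
      unfolding \<nu>_def by (intro max normalize that False)
    then have "(y \<bullet> (K *v y)) / (y \<bullet> (M *v y)) \<le> \<nu>"
      using M_pos[OF False] by (subst (asm) M_scale) (simp add: power_divide)
    then show ?thesis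
      using M_pos[OF False] by (simp add: D_def inner_diff_right field_simps)
  qed simp
  have xD: "x \<bullet> D x = 0"
    by (simp add: D_def inner_diff_right xM \<nu>_def)
  have orth_S: "D x \<bullet> y = 0" if "y \<in> S" for y
  proof (rule quadratic_nonpos_imp_linear_coeff_zero)
    fix t
    have "(x + t *\<^sub>R y) \<bullet> D (x + t *\<^sub>R y) \<le> 0"
      by (intro nonpos S_sub xS that)
    moreover have "(x + t *\<^sub>R y) \<bullet> D (x + t *\<^sub>R y) = 2 * t * (D x \<bullet> y) + t\<^sup>2 * (y \<bullet> D y)"
      using xD D_inner[of x y]
      by (simp add: D_add inner_add_left inner_add_right inner_commute power2_eq_square algebra_simps)
    ultimately show "2 * t * (D x \<bullet> y) + t\<^sup>2 * (y \<bullet> D y) \<le> 0" by simp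
  qed
  have orth_W: "D x \<bullet> u = 0" if "u \<in> W" for u
  proof -
    have "\<exists>\<mu>>0. K *v u = \<mu> *\<^sub>R (M *v u)" using W that by (simp add: normal_modes_def)
    then obtain \<mu> where "K *v u = \<mu> *\<^sub>R (M *v u)" by blast
    then show ?thesis
      using xS that by (simp add: D_inner) (simp add: D_def S_def inner_diff_right)
  qed
  have "D x \<bullet> y = 0" for y
  proof -
    have "D x \<bullet> P y = 0" by (simp add: P_def inner_sum_right orth_W)
    moreover have "D x \<bullet> (y - P y) = 0" by (intro orth_S PS)
    ultimately show ?thesis by (simp add: inner_diff_right)
  qed
  then have "D x = 0" by (metis inner_eq_zero_iff)
  then have eig: "K *v x = \<nu> *\<^sub>R (M *v x)" by (simp add: D_def)
  have "x \<notin> W" using xS xM by (auto simp: S_def)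
  moreover have "x \<bullet> (M *v v) = 0" "v \<bullet> (M *v x) = 0" if "v \<in> W" for v
    using that xS M_inner[of x v] by (auto simp: S_def inner_commute)
  ultimately have "normal_modes (insert x W)"
    using W xM eig \<open>\<nu> > 0\<close> by (auto simp: normal_modes_def)
  with \<open>x \<notin> W\<close> show ?thesis by blast
qed

lemma ex_normal_modes: "n \<le> CARD('m) \<Longrightarrow> \<exists>W. normal_modes W \<and> card W = n"
proof (induction n)
  case 0
  show ?case by (rule exI[of _ "{}"]) (simp add: normal_modes_def)
next
  case (Suc n)
  then obtain W where W: "normal_modes W" "card W = n" by auto
  then obtain x where "x \<notin> W" "normal_modes (insert x W)"
    using normal_modes_extend[of W] Suc.prems by auto
  then show ?case
    using W by (metis card_insert_disjoint normal_modes_def)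
qed

text \<open>A full set of modes is indexed by \<open>'m\<close>, which lets distinct modes share a
  frequency. The frequencies are the square roots of the eigenvalues.\<close>

lemma simultaneous_diagonalization:
  obtains w :: "'m \<Rightarrow> real^'m" and \<omega> :: "'m \<Rightarrow> real" where
    "\<And>r s. w r \<bullet> (M *v w s) = of_bool (r = s)" "\<And>r. \<omega> r > 0"
    "\<And>r. K *v w r = (\<omega> r)\<^sup>2 *\<^sub>R (M *v w r)"
proof -
  obtain W where W: "normal_modes W" "card W = CARD('m)"
    using ex_normal_modes by blast
  then obtain w where w: "bij_betw w (UNIV :: 'm set) W"
    by (metis finite_same_card_bij finite normal_modes_def)
  then have wW: "w r \<in> W" and inj: "w r = w s \<longleftrightarrow> r = s" for r s
    by (auto simp: bij_betw_def inj_eq)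
  have "\<exists>\<nu>>0. K *v w r = \<nu> *\<^sub>R (M *v w r)" for r
    using W wW by (simp add: normal_modes_def)
  then obtain \<nu> where "\<And>r. \<nu> r > 0" "\<And>r. K *v w r = \<nu> r *\<^sub>R (M *v w r)"
    by metis
  then show ?thesis
    using W wW inj by (intro that[of w "\<lambda>r. sqrt (\<nu> r)"]) (auto simp: normal_modes_def less_imp_le)
qed

section \<open>Energy, stability and center\<close>

text \<open>The Birkhoffian re-centred at its equilibrium: the constant term is absorbed into
  \<open>q - q\<^sub>e\<close>.\<close>

definition balance :: "real^'m \<Rightarrow> real^'m \<Rightarrow> real^'m \<Rightarrow> real^'m \<Rightarrow> real^'m" where
  "balance q\<^sub>e q q' q'' = M *v q'' + K *v (q - q\<^sub>e)"

text \<open>Magnetic energy of the inductors plus electric energy of the capacitors, the latter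
  counted from its equilibrium value.\<close>

definition energy :: "real^'m \<Rightarrow> (real^'m) \<times> (real^'m) \<Rightarrow> real" where
  "energy q\<^sub>e z = (snd z \<bullet> (M *v snd z) + (fst z - q\<^sub>e) \<bullet> (K *v (fst z - q\<^sub>e))) / 2"

text \<open>Symmetry merges the two terms of the product rule, and the resulting 2 cancels the
  factor 1/2. The set \<open>S\<close> is left open so that the rule serves both Frechet derivatives
  and the chain rule along a motion.\<close>

lemma energy_has_derivative:
  "(energy q\<^sub>e has_derivative
     (\<lambda>h. snd h \<bullet> (M *v snd z) + fst h \<bullet> (K *v (fst z - q\<^sub>e)))) (at z within S)"
proof -
  have 1: "((\<lambda>z. A *v f z) has_derivative (\<lambda>h. A *v f' h)) (at z within S)"
    if "(f has_derivative f') (at z within S)" for A :: "real^'m^'m" and f f' 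
    using bounded_linear.has_derivative[OF matrix_vector_mul_bounded_linear that] .
  have 2: "((\<lambda>z. f z \<bullet> (A *v f z)) has_derivative (\<lambda>h. 2 * (f' h \<bullet> (A *v f z)))) (at z within S)"
    if "transpose A = A" and f: "(f has_derivative f') (at z within S)" for A :: "real^'m^'m" and f f'
  proof -
    have "f z \<bullet> (A *v f' h) + f' h \<bullet> (A *v f z) = 2 * (f' h \<bullet> (A *v f z))" for h
      using matrix_inner_symmetric[OF that(1), of "f z" "f' h"] by (simp add: inner_commute)
    then show ?thesis
      using has_derivative_inner[OF f 1[OF f, of A]] by simp
  qed
  have "((\<lambda>z. (snd z \<bullet> (M *v snd z) + (fst z - q\<^sub>e) \<bullet> (K *v (fst z - q\<^sub>e))) * (1 / 2)) has_derivative
      (\<lambda>h. (2 * (snd h \<bullet> (M *v snd z)) + 2 * (fst h \<bullet> (K *v (fst z - q\<^sub>e)))) * (1 / 2))) (at z within S)"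
    by (intro has_derivative_mult_left has_derivative_add 2 M_sym K_sym)
      (auto intro!: derivative_eq_intros)
  then show ?thesis
    by (simp add: energy_def [abs_def] add_divide_distrib)
qed

lemma energy_pos: "z \<noteq> (q\<^sub>e, 0) \<Longrightarrow> energy q\<^sub>e z > 0"
proof -
  assume z: "z \<noteq> (q\<^sub>e, 0)"
  have nonneg: "x \<bullet> (M *v x) \<ge> 0" "x \<bullet> (K *v x) \<ge> 0" for x
    using M_pos[of x] K_pos[of x] by (cases "x = 0"; simp)+
  consider "snd z \<noteq> 0" | "fst z - q\<^sub>e \<noteq> 0"
    using z by (cases z) auto
  then show ?thesis
    using nonneg[of "snd z"] nonneg[of "fst z - q\<^sub>e"] M_pos[of "snd z"] K_pos[of "fst z - q\<^sub>e"]
    by cases (simp_all add: energy_def)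
qed

text \<open>Both quadratic forms dominate a multiple of the squared norm. Hence low energy confines
  a state to a small ball.\<close>

lemma energy_coercive:
  obtains c where "c > 0" "\<And>z. c * (dist z (q\<^sub>e, 0))\<^sup>2 \<le> energy q\<^sub>e z"
proof -
  obtain c1 where c1: "c1 > 0" "\<And>x. c1 * (norm x)\<^sup>2 \<le> x \<bullet> (M *v x)"
    using pos_def_lower_bound M_pos by blast
  obtain c2 where c2: "c2 > 0" "\<And>x. c2 * (norm x)\<^sup>2 \<le> x \<bullet> (K *v x)"
    using pos_def_lower_bound K_pos by blast
  define c where "c = min c1 c2"
  have c: "c \<le> c1" "c \<le> c2" "c > 0" using c1 c2 by (auto simp: c_def)
  have "c / 2 * (dist z (q\<^sub>e, 0))\<^sup>2 \<le> energy q\<^sub>e z" for z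
  proof -
    have "c * (norm (snd z))\<^sup>2 \<le> snd z \<bullet> (M *v snd z)"
      using c1(2)[of "snd z"] c(1) by (meson mult_right_mono order_trans zero_le_power2)
    moreover have "c * (norm (fst z - q\<^sub>e))\<^sup>2 \<le> (fst z - q\<^sub>e) \<bullet> (K *v (fst z - q\<^sub>e))"
      using c2(2)[of "fst z - q\<^sub>e"] c(2) by (meson mult_right_mono order_trans zero_le_power2)
    moreover have "(dist z (q\<^sub>e, 0))\<^sup>2 = (norm (fst z - q\<^sub>e))\<^sup>2 + (norm (snd z))\<^sup>2"
      by (simp add: dist_prod_def dist_norm)
    ultimately show ?thesis by (simp add: energy_def field_simps)
  qed
  then show ?thesis using that[of "c / 2"] c by simp
qed

text \<open>The time derivative of the energy is the inner product of \<open>q'\<close> with the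
  left side of the equation of motion, hence 0.\<close>

lemma energy_conserved:
  assumes "convex I" and mot: "motion_on (balance q\<^sub>e) I q q'" and "s \<in> I" "t \<in> I"
  shows "energy q\<^sub>e (q s, q' s) = energy q\<^sub>e (q t, q' t)"
proof -
  have "((\<lambda>t. energy q\<^sub>e (q t, q' t)) has_real_derivative 0) (at t within I)" if t: "t \<in> I" for t
  proof -
    obtain a where q: "(q has_vector_derivative q' t) (at t within I)"
      and q': "(q' has_vector_derivative a) (at t within I)"
      and bal: "M *v a + K *v (q t - q\<^sub>e) = 0"
      using mot t unfolding motion_on_def balance_def by blast
    have "((\<lambda>t. energy q\<^sub>e (q t, q' t)) has_vector_derivative
        (a \<bullet> (M *v q' t) + q' t \<bullet> (K *v (q t - q\<^sub>e)))) (at t within I)"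
      using vector_derivative_diff_chain_within
        [OF has_vector_derivative_Pair[OF q q'] energy_has_derivative]
      by (simp add: o_def)
    moreover have "a \<bullet> (M *v q' t) + q' t \<bullet> (K *v (q t - q\<^sub>e)) = q' t \<bullet> (M *v a + K *v (q t - q\<^sub>e))"
      using M_inner[of a "q' t"] by (simp add: inner_add_right inner_commute)
    ultimately show ?thesis
      by (simp add: bal has_real_derivative_iff_has_vector_derivative)
  qed
  from has_field_derivative_zero_constant[OF \<open>convex I\<close> this]
  show ?thesis using assms(3,4) by auto
qed

lemma stable_equilibrium_balance: "stable_equilibrium (balance q\<^sub>e) (q\<^sub>e, 0)"
  unfolding stable_equilibrium_def
proof (intro allI impI)
  fix \<Omega> :: "((real^'m) \<times> (real^'m)) set"
  assume "open \<Omega> \<and> (q\<^sub>e, 0) \<in> \<Omega>"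
  then obtain \<epsilon> where \<epsilon>: "\<epsilon> > 0" "ball (q\<^sub>e, 0) \<epsilon> \<subseteq> \<Omega>"
    by (meson open_contains_ball)
  obtain c where c: "c > 0" "\<And>z. c * (dist z (q\<^sub>e, 0))\<^sup>2 \<le> energy q\<^sub>e z"
    using energy_coercive by blast
  \<comment> \<open>By coercivity energy below \<open>c * \<epsilon>\<^sup>2\<close> forces distance
    below \<open>\<epsilon>\<close>; by conservation motions cannot leave this set.\<close>
  define \<Omega>1 where "\<Omega>1 = {z. energy q\<^sub>e z < c * \<epsilon>\<^sup>2}"
  have "\<Omega>1 \<subseteq> ball (q\<^sub>e, 0) \<epsilon>"
  proof
    fix z assume "z \<in> \<Omega>1"
    then have "c * (dist z (q\<^sub>e, 0))\<^sup>2 < c * \<epsilon>\<^sup>2"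
      using c(2)[of z] by (simp add: \<Omega>1_def)
    then show "z \<in> ball (q\<^sub>e, 0) \<epsilon>"
      using c(1) \<epsilon>(1) by (simp add: dist_commute power_less_imp_less_base)
  qed
  then have sub: "\<Omega>1 \<subseteq> \<Omega>" using \<epsilon> by blast
  have "continuous_on UNIV (energy q\<^sub>e)"
    by (intro continuous_at_imp_continuous_on ballI has_derivative_continuous[OF energy_has_derivative])
  then have op: "open \<Omega>1"
    unfolding \<Omega>1_def by (intro open_Collect_less continuous_on_const)
  have centre: "(q\<^sub>e, 0) \<in> \<Omega>1" using c \<epsilon> by (simp add: \<Omega>1_def energy_def)
  have invariant: "(q t, q' t) \<in> \<Omega>"
    if "is_interval I" "0 \<in> I" "motion_on (balance q\<^sub>e) I q q'" "(q 0, q' 0) \<in> \<Omega>1" "t \<in> I" for I q q' t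
  proof -
    have "energy q\<^sub>e (q 0, q' 0) = energy q\<^sub>e (q t, q' t)"
      using that by (intro energy_conserved) (auto simp: is_interval_convex_1)
    then show ?thesis using that sub by (auto simp: \<Omega>1_def)
  qed
  show "\<exists>\<Omega>1\<subseteq>\<Omega>. open \<Omega>1 \<and> (q\<^sub>e, 0) \<in> \<Omega>1 \<and>
      (\<forall>I q q'. is_interval I \<and> 0 \<in> I \<and> I \<subseteq> {0..} \<and> motion_on (balance q\<^sub>e) I q q' \<and>
        (q 0, q' 0) \<in> \<Omega>1 \<longrightarrow> (\<forall>t\<in>I. (q t, q' t) \<in> \<Omega>))"
    using invariant by (intro exI[of _ \<Omega>1] conjI allI impI ballI sub op centre) (elim conjE)
qed

section \<open>The Birkhoffian vector field and the center\<close>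

text \<open>Positive definiteness excludes a kernel. With \<open>M_surj\<close> it makes the
  acceleration at each state exist uniquely, so that \<open>birkhoff_field\<close> is well
  defined.\<close>

lemma M_inj: "M *v x = M *v y \<Longrightarrow> x = y"
proof (rule ccontr)
  assume "M *v x = M *v y" "x \<noteq> y"
  then show False
    using M_pos[of "x - y"] by (simp add: matrix_vector_mult_diff_distrib)
qed

lemma M_surj: obtains x where "M *v x = y"
proof -
  have "inj ((*v) M)" using M_inj by (auto intro: injI)
  then have "surj ((*v) M)"
    by (simp add: linear_injective_imp_surjective)
  then show ?thesis using that by (metis surjD)
qed

text \<open>Once the acceleration \<open>a\<close> is known, symmetry of \<open>M\<close> makes the
  kinetic and potential contributions cancel.\<close>

lemma energy_orbital_derivative:
  "frechet_derivative (energy q\<^sub>e) (at z) (birkhoff_field (balance q\<^sub>e) z) = 0"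
proof -
  obtain a where a: "M *v a = - (K *v (fst z - q\<^sub>e))"
    using M_surj by blast
  have "(THE a. balance q\<^sub>e (fst z) (snd z) a = 0) = a"
  proof (rule the_equality)
    show "balance q\<^sub>e (fst z) (snd z) a = 0" by (simp add: balance_def a)
  next
    fix b assume "balance q\<^sub>e (fst z) (snd z) b = 0"
    then have "M *v b = M *v a" by (simp add: balance_def a eq_neg_iff_add_eq_0)
    then show "b = a" by (rule M_inj)
  qed
  moreover have "frechet_derivative (energy q\<^sub>e) (at z) =
      (\<lambda>h. snd h \<bullet> (M *v snd z) + fst h \<bullet> (K *v (fst z - q\<^sub>e)))"
    by (rule frechet_derivative_at[OF energy_has_derivative, symmetric])
  ultimately show ?thesis
    using a M_inner[of a "snd z"] by (simp add: birkhoff_field_def inner_commute)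
qed

text \<open>The energy is a Liapunov function on the whole state space, so \<open>\<Omega>\<close>
  is \<open>UNIV\<close>.\<close>

lemma center_balance: "center (balance q\<^sub>e) (q\<^sub>e, 0)"
proof -
  define D where "D z = Blinfun (\<lambda>h. snd h \<bullet> (M *v snd z) + fst h \<bullet> (K *v (fst z - q\<^sub>e)))"
    for z :: "(real^'m) \<times> (real^'m)"
  have D: "blinfun_apply (D z) = (\<lambda>h. snd h \<bullet> (M *v snd z) + fst h \<bullet> (K *v (fst z - q\<^sub>e)))" for z
    unfolding D_def
    by (rule bounded_linear_Blinfun_apply) (rule has_derivative_bounded_linear[OF energy_has_derivative])
  \<comment> \<open>In finite dimension continuity in the operator norm can be tested on basis
    vectors.\<close>
  have "continuous_on UNIV D"
    by (rule continuous_on_blinfun_componentwise)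
      (auto simp: D intro!: continuous_intros bounded_linear.continuous_on[OF matrix_vector_mul_bounded_linear])
  then have "C1_on (energy q\<^sub>e) UNIV"
    unfolding C1_on_def by (intro exI[of _ D]) (simp add: D energy_has_derivative)
  then have "liapunov_function (balance q\<^sub>e) (q\<^sub>e, 0) (energy q\<^sub>e) UNIV"
    unfolding liapunov_function_def
    by (auto simp: energy_pos energy_orbital_derivative) (simp add: energy_def)
  then show ?thesis
    unfolding center_def using energy_orbital_derivative by blast
qed

end

section \<open>Normal modes of oscillation\<close>

text \<open>The modal coordinates of \<open>x\<close> are the numbers
  \<open>x \<bullet> (M *v w r)\<close>.\<close>

locale normal_coordinates = oscillator M K for M K :: "real^'m::finite^'m" +
  fixes w :: "'m \<Rightarrow> real^'m" and \<omega> :: "'m \<Rightarrow> real"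
  assumes orthonormal: "w r \<bullet> (M *v w s) = of_bool (r = s)"
    and \<omega>_pos: "\<omega> r > 0"
    and eigen: "K *v w r = (\<omega> r)\<^sup>2 *\<^sub>R (M *v w r)"
begin

lemma inner_sum_w: "(\<Sum>s\<in>UNIV. f s *\<^sub>R w s) \<bullet> (M *v w r) = f r"
  by (simp add: inner_sum_left orthonormal)

lemma inj_w: "inj w"
proof (rule injI)
  fix r s assume "w r = w s"
  then show "r = s" using orthonormal[of r s] orthonormal[of r r] by (auto split: if_splits)
qed

lemma independent_w: "independent (range w)"
proof -
  have "f (w r) = 0" if "(\<Sum>v\<in>range w. f v *\<^sub>R v) = 0" for f r
  proof -
    have "(\<Sum>v\<in>range w. f v *\<^sub>R v) = (\<Sum>s\<in>UNIV. f (w s) *\<^sub>R w s)"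
      by (simp add: sum.reindex inj_w)
    then show ?thesis
      using inner_sum_w[of "\<lambda>s. f (w s)" r] that by simp
  qed
  then show ?thesis by (auto simp: independent_explicit_finite_subsets dependent_finite)
qed

text \<open>The modes span by counting dimensions, and \<open>M\<close>-orthonormality identifies
  the coefficients.\<close>

lemma expansion: "x = (\<Sum>r\<in>UNIV. (x \<bullet> (M *v w r)) *\<^sub>R w r)"
proof -
  have "UNIV \<subseteq> span (range w)"
    by (rule card_ge_dim_independent) (simp_all add: independent_w card_image inj_w)
  then have "x \<in> span (range w)" by blast
  then obtain f where "x = (\<Sum>v\<in>range w. f v *\<^sub>R v)"
    by (auto simp: span_finite)
  then have x: "x = (\<Sum>r\<in>UNIV. f (w r) *\<^sub>R w r)"
    by (simp add: sum.reindex inj_w)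
  then have "x \<bullet> (M *v w r) = f (w r)" for r
    by (metis inner_sum_w[of "\<lambda>r. f (w r)"])
  then show ?thesis using x by simp
qed

text \<open>Symmetry moves \<open>M\<close> and \<open>K\<close> onto \<open>w r\<close>, where
  \<open>K\<close> acts as \<open>(\<omega> r)\<^sup>2\<close> times \<open>M\<close>. Each modal
  coordinate thus solves a scalar oscillator equation.\<close>

lemma motion_is_superposition:
  assumes I: "is_interval I" and mot: "motion_on (balance q\<^sub>e) I q q'"
  shows "\<exists>A B. \<forall>t\<in>I. q t = superposition q\<^sub>e \<omega> w A B t"
proof -
  have "\<exists>a b. \<forall>t\<in>I. (q t - q\<^sub>e) \<bullet> (M *v w r) = a * cos (\<omega> r * t) + b * sin (\<omega> r * t)" for r
  proof -
    have u: "((\<lambda>t. (q t - q\<^sub>e) \<bullet> (M *v w r)) has_vector_derivative q' t \<bullet> (M *v w r)) (at t within I)"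
      and v: "((\<lambda>t. q' t \<bullet> (M *v w r)) has_vector_derivative
              - (\<omega> r)\<^sup>2 * ((q t - q\<^sub>e) \<bullet> (M *v w r))) (at t within I)" if t: "t \<in> I" for t
    proof -
      obtain a where q: "(q has_vector_derivative q' t) (at t within I)"
        and q': "(q' has_vector_derivative a) (at t within I)"
        and bal: "M *v a + K *v (q t - q\<^sub>e) = 0"
        using mot t unfolding motion_on_def balance_def by blast
      have "((\<lambda>t. q t - q\<^sub>e) has_vector_derivative q' t) (at t within I)"
        using has_vector_derivative_diff[OF q has_vector_derivative_const] by simp
      from bounded_linear.has_vector_derivative[OF bounded_linear_inner_left this]
      show "((\<lambda>t. (q t - q\<^sub>e) \<bullet> (M *v w r)) has_vector_derivative q' t \<bullet> (M *v w r)) (at t within I)" .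
      have "M *v a = - (K *v (q t - q\<^sub>e))" using bal by (simp add: eq_neg_iff_add_eq_0)
      then have "a \<bullet> (M *v w r) = - (\<omega> r)\<^sup>2 * ((q t - q\<^sub>e) \<bullet> (M *v w r))"
        using M_inner[of a "w r"] K_inner[of "q t - q\<^sub>e" "w r"] by (simp add: eigen)
      then show "((\<lambda>t. q' t \<bullet> (M *v w r)) has_vector_derivative
              - (\<omega> r)\<^sup>2 * ((q t - q\<^sub>e) \<bullet> (M *v w r))) (at t within I)"
        using bounded_linear.has_vector_derivative[OF bounded_linear_inner_left q', of "M *v w r"]
        by simp
    qed
    show ?thesis
    proof (rule harmonic_oscillator_unique[OF I _ u v])
      show "\<omega> r \<noteq> 0" using \<omega>_pos[of r] by simp
    qed
  qed
  then obtain A B where AB: "\<And>r t. t \<in> I \<Longrightarrow>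
      (q t - q\<^sub>e) \<bullet> (M *v w r) = A r * cos (\<omega> r * t) + B r * sin (\<omega> r * t)"
    by metis
  have "q t = superposition q\<^sub>e \<omega> w A B t" if "t \<in> I" for t
    using expansion[of "q t - q\<^sub>e"] AB[OF that] by (simp add: superposition_def algebra_simps)
  then show ?thesis by blast
qed

text \<open>The converse for all times: differentiate termwise and cancel mode by mode with
  \<open>eigen\<close>.\<close>

lemma superposition_is_motion:
  "\<exists>q'. motion_on (balance q\<^sub>e) UNIV (superposition q\<^sub>e \<omega> w A B) q'"
proof -
  define q' where "q' t = (\<Sum>r\<in>UNIV. (- A r * \<omega> r * sin (\<omega> r * t) + B r * \<omega> r * cos (\<omega> r * t)) *\<^sub>R w r)" for t
  define q'' where "q'' t = (\<Sum>r\<in>UNIV. (- (\<omega> r)\<^sup>2 * (A r * cos (\<omega> r * t) + B r * sin (\<omega> r * t))) *\<^sub>R w r)" for t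
  have 1: "((\<lambda>t. \<Sum>r\<in>UNIV. f r t *\<^sub>R w r) has_vector_derivative (\<Sum>r\<in>UNIV. f' r *\<^sub>R w r)) (at t)"
    if "\<And>r. (f r has_real_derivative f' r) (at t)" for f f' t
  proof (rule has_vector_derivative_sum)
    fix r
    show "((\<lambda>t. f r t *\<^sub>R w r) has_vector_derivative f' r *\<^sub>R w r) (at t)"
      using has_vector_derivative_scaleR[OF that[of r] has_vector_derivative_const[of "w r"]] by simp
  qed
  have mult_sum: "X *v (\<Sum>r\<in>UNIV. f r *\<^sub>R w r) = (\<Sum>r\<in>UNIV. f r *\<^sub>R (X *v w r))" for X :: "real^'m^'m" and f
    by (simp add: linear_sum[OF matrix_vector_mul_linear] matrix_vector_mult_scaleR)
  \<comment> \<open>The summand 0 is the derivative of the constant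
    \<open>q\<^sub>e\<close>.\<close>
  have "(superposition q\<^sub>e \<omega> w A B has_vector_derivative 0 + q' t) (at t)" for t
    unfolding superposition_def [abs_def] q'_def
    by (rule has_vector_derivative_add[OF has_vector_derivative_const 1])
      (auto intro!: derivative_eq_intros simp: algebra_simps)
  moreover have "(q' has_vector_derivative q'' t) (at t)" for t
    unfolding q'_def [abs_def] q''_def
    by (rule 1) (auto intro!: derivative_eq_intros simp: algebra_simps power2_eq_square)
  moreover have "balance q\<^sub>e (superposition q\<^sub>e \<omega> w A B t) (q' t) (q'' t) = 0" for t
  proof -
    have "M *v q'' t = (\<Sum>r\<in>UNIV. (- (\<omega> r)\<^sup>2 * (A r * cos (\<omega> r * t) + B r * sin (\<omega> r * t))) *\<^sub>R (M *v w r))"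
      by (simp only: q''_def mult_sum)
    moreover have "K *v (superposition q\<^sub>e \<omega> w A B t - q\<^sub>e) =
        (\<Sum>r\<in>UNIV. ((\<omega> r)\<^sup>2 * (A r * cos (\<omega> r * t) + B r * sin (\<omega> r * t))) *\<^sub>R (M *v w r))"
      by (simp add: superposition_def mult_sum eigen mult.commute)
    ultimately show ?thesis
      by (simp add: balance_def sum.distrib[symmetric] scaleR_add_left[symmetric])
  qed
  ultimately show ?thesis
    unfolding motion_on_def by (intro exI[of _ q']) auto
qed

section \<open>Periodicity and commensurable frequencies\<close>

text \<open>Every modal coordinate inherits the period \<open>T\<close>, so for excited modes
  \<open>\<omega> r * T\<close> is an integer multiple of \<open>2 * pi\<close>; quotients of such
  numbers are rational.\<close>

lemma periodic_superposition_imp_commensurable: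
  assumes "periodic (superposition q\<^sub>e \<omega> w A B)" "r \<in> excited A B" "s \<in> excited A B"
  shows "\<omega> r / \<omega> s \<in> \<rat>"
proof -
  obtain T where T: "T > 0"
    "\<And>t. superposition q\<^sub>e \<omega> w A B (t + T) = superposition q\<^sub>e \<omega> w A B t"
    using assms(1) by (auto simp: periodic_def)
  have coord: "(superposition q\<^sub>e \<omega> w A B t - q\<^sub>e) \<bullet> (M *v w r) = A r * cos (\<omega> r * t) + B r * sin (\<omega> r * t)"
    for r t by (simp add: superposition_def inner_sum_w)
  have per: "\<exists>n::int. \<omega> r * T = of_int n * 2 * pi" if "r \<in> excited A B" for r
  proof (rule harmonic_period)
    show "A r * cos (\<omega> r * (t + T)) + B r * sin (\<omega> r * (t + T)) = A r * cos (\<omega> r * t) + B r * sin (\<omega> r * t)" for t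
      using coord T(2) by metis
    show "A r \<noteq> 0 \<or> B r \<noteq> 0" using that by (simp add: excited_def)
    show "\<omega> r \<noteq> 0" using \<omega>_pos[of r] by simp
  qed blast
  obtain m n :: int where "\<omega> r * T = of_int m * 2 * pi" "\<omega> s * T = of_int n * 2 * pi"
    using per assms(2,3) by blast
  moreover have "\<omega> r / \<omega> s = (\<omega> r * T) / (\<omega> s * T)" using T by simp
  ultimately have "\<omega> r / \<omega> s = of_int m / of_int n" by simp
  then show ?thesis by simp
qed

lemma commensurable_imp_periodic_superposition:
  assumes comm: "\<And>r s. r \<in> excited A B \<Longrightarrow> s \<in> excited A B \<Longrightarrow> \<omega> r / \<omega> s \<in> \<rat>"
  shows "periodic (superposition q\<^sub>e \<omega> w A B)"
proof (cases "excited A B = {}")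
  case True
  then have "A r = 0" "B r = 0" for r by (auto simp: excited_def)
  \<comment> \<open>Without excited modes the function is constant, and 1 is a period.\<close>
  then show ?thesis by (auto simp: periodic_def superposition_def intro: exI[of _ 1])
next
  case False
  then obtain s where s: "s \<in> excited A B" by blast
  obtain d :: nat where d: "d > 0" "\<And>r. r \<in> excited A B \<Longrightarrow> of_nat d * (\<omega> r / \<omega> s) \<in> \<int>"
    using finite_Rats_common_denominator[of "(\<lambda>r. \<omega> r / \<omega> s) ` excited A B"] comm s
    by (auto simp: image_subset_iff)
  \<comment> \<open>\<open>d\<close> full turns of the reference mode \<open>s\<close> make an
    integer number of turns in every excited mode.\<close>
  define T where "T = 2 * pi * of_nat d / \<omega> s"
  have "(A r * cos (\<omega> r * (t + T)) + B r * sin (\<omega> r * (t + T))) =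
      (A r * cos (\<omega> r * t) + B r * sin (\<omega> r * t))" for r t
  proof (cases "r \<in> excited A B")
    case True
    then obtain n where n: "of_nat d * (\<omega> r / \<omega> s) = of_int n"
      using d(2) by (meson Ints_cases)
    then have "\<omega> r * (t + T) = \<omega> r * t + 2 * pi * of_int n"
      by (simp add: T_def algebra_simps flip: n)
    then show ?thesis
      by (simp add: cos_add sin_add)
  qed (simp add: excited_def)
  moreover have "T > 0" using d(1) \<omega>_pos by (simp add: T_def)
  ultimately show ?thesis
    by (auto simp: periodic_def superposition_def intro!: exI[of _ T])
qed

end

section \<open>The network\<close>

text \<open>The matrix is the product of the transpose of \<open>N\<close>, the diagonal matrix of
  weights and \<open>N\<close>, where the \<open>N k\<close> are the rows; it is applied factor by
  factor.\<close>

lemma mult_weighted_gram: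
  fixes N :: "'k::finite \<Rightarrow> real^'m::finite"
  shows "((\<chi> j i. \<Sum>k\<in>UNIV. d k * N k $ j * N k $ i) *v x) $ j = (\<Sum>k\<in>UNIV. d k * N k $ j * (N k \<bullet> x))"
proof -
  have "(\<Sum>i\<in>UNIV. (\<Sum>k\<in>UNIV. d k * N k $ j * N k $ i) * x $ i) =
      (\<Sum>i\<in>UNIV. \<Sum>k\<in>UNIV. d k * N k $ j * (N k $ i * x $ i))"
    by (simp only: sum_distrib_right mult.assoc)
  also have "\<dots> = (\<Sum>k\<in>UNIV. \<Sum>i\<in>UNIV. d k * N k $ j * (N k $ i * x $ i))"
    by (rule sum.swap)
  finally show ?thesis
    by (simp add: matrix_vector_mult_def inner_vec_def sum_distrib_left)
qed

text \<open>The form is the sum of \<open>d k * (N k \<bullet> x)\<^sup>2\<close>. If it vanishes,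
  so does every \<open>N k \<bullet> x\<close>, hence \<open>A *v x = 0\<close>, which the
  determinant excludes for nonzero \<open>x\<close>.\<close>

lemma weighted_gram_pos_def:
  fixes N :: "'k::finite \<Rightarrow> real^'m::finite" and A :: "real^'m^'m"
  assumes A: "A = (\<chi> j i. \<Sum>k\<in>UNIV. d k * N k $ j * N k $ i)"
    and d: "\<And>k. d k > 0" and det: "det A \<noteq> 0" and "x \<noteq> 0"
  shows "x \<bullet> (A *v x) > 0"
proof -
  have "x \<bullet> (A *v x) = (\<Sum>j\<in>UNIV. \<Sum>k\<in>UNIV. d k * (x $ j * N k $ j) * (N k \<bullet> x))"
    by (simp add: inner_vec_def[of x] A mult_weighted_gram) (simp add: sum_distrib_left mult_ac)
  also have "\<dots> = (\<Sum>k\<in>UNIV. \<Sum>j\<in>UNIV. d k * (x $ j * N k $ j) * (N k \<bullet> x))"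
    by (rule sum.swap)
  also have "\<dots> = (\<Sum>k\<in>UNIV. d k * (N k \<bullet> x)\<^sup>2)"
    by (simp add: inner_vec_def[of _ x] sum_distrib_left sum_distrib_right power2_eq_square mult_ac)
  finally have eq: "x \<bullet> (A *v x) = (\<Sum>k\<in>UNIV. d k * (N k \<bullet> x)\<^sup>2)" .
  moreover have nonneg: "d k * (N k \<bullet> x)\<^sup>2 \<ge> 0" for k
    using d[of k] by simp
  moreover have "(\<Sum>k\<in>UNIV. d k * (N k \<bullet> x)\<^sup>2) \<noteq> 0"
  proof
    assume "(\<Sum>k\<in>UNIV. d k * (N k \<bullet> x)\<^sup>2) = 0"
    then have "d k * (N k \<bullet> x)\<^sup>2 = 0" for k
      using nonneg by (simp add: sum_nonneg_eq_0_iff)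
    then have "N k \<bullet> x = 0" for k
      using d[of k] by (metis less_irrefl mult_eq_0_iff power_eq_0_iff)
    then have "A *v x = 0"
      by (simp add: vec_eq_iff A mult_weighted_gram)
    moreover have "invertible A" using det by (simp add: invertible_det_nz)
    ultimately show False
      using \<open>x \<noteq> 0\<close> by (metis invertible_def matrix_vector_mul_assoc matrix_vector_mul_lid
          matrix_vector_mult_0_right)
  qed
  moreover have "(\<Sum>k\<in>UNIV. d k * (N k \<bullet> x)\<^sup>2) \<ge> 0"
    by (intro sum_nonneg nonneg)
  ultimately show ?thesis
    by simp
qed

lemma transpose_weighted_gram:
  fixes N :: "'k::finite \<Rightarrow> real^'m::finite"
  shows "transpose (\<chi> j i. \<Sum>k\<in>UNIV. d k * N k $ j * N k $ i) = (\<chi> j i. \<Sum>k\<in>UNIV. d k * N k $ j * N k $ i)"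
  by (simp add: transpose_def vec_eq_iff mult_ac)

text \<open>With incommensurable frequencies a motion is only quasi-periodic. The periodicity claim
  is therefore stated through normal modes: motions are superpositions of harmonic oscillations, and
  a superposition is periodic exactly when its excited frequencies are commensurable.\<close>

theorem theorem1:
  fixes G :: "('n::finite option, 'l::finite + 'c::finite) pre_digraph"
    and L :: "real^'l" and C :: "real^'c" and \<cc> :: "real^'n"
    and \<N> :: "real^'m::finite^('l + 'c)" and \<K> :: "real^('l + 'c)" and \<kappa> :: "real^'c"
    and const :: "real^'m"
    and Q :: "real^'m \<Rightarrow> real^'m \<Rightarrow> real^'m \<Rightarrow> real^'m"
  assumes network: "lc_network G L C \<cc> \<N> \<K>"
    and Q: "Q = birkhoffian L C \<N> \<K> \<kappa>"
    and components: "Q = lc_components L C \<N> const"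
    and det_L: "det (\<chi> j i. \<Sum>a\<in>UNIV. L $ a * \<N> $ Inl a $ j * \<N> $ Inl a $ i) \<noteq> 0"
    and det_C: "det (\<chi> j i. \<Sum>\<alpha>\<in>UNIV. \<N> $ Inr \<alpha> $ j * \<N> $ Inr \<alpha> $ i / C $ \<alpha>) \<noteq> 0"
  shows
    "(\<forall>q\<^sub>e. equilibrium_point Q (q\<^sub>e, 0) \<longrightarrow>
        (\<forall>j. (\<Sum>\<alpha>\<in>UNIV. \<Sum>i\<in>UNIV. \<N> $ Inr \<alpha> $ j * \<N> $ Inr \<alpha> $ i / C $ \<alpha> * q\<^sub>e $ i)
             + const $ j = 0)) \<and>
     (\<forall>d. \<exists>!z. equilibrium_point (lc_components L C \<N> d) z) \<and>
     ((\<forall>a. L $ a > 0) \<and> (\<forall>\<alpha>. C $ \<alpha> > 0) \<longrightarrow>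
        (\<forall>q\<^sub>e. equilibrium_point Q (q\<^sub>e, 0) \<longrightarrow>
           stable_equilibrium Q (q\<^sub>e, 0) \<and> center Q (q\<^sub>e, 0) \<and>
           (\<exists>\<omega> w. (\<forall>r. \<omega> r > 0) \<and> inj w \<and> independent (range w) \<and>
              (\<forall>I q q'. is_interval I \<and> (\<exists>s\<in>I. \<exists>t\<in>I. s < t) \<and> motion_on Q I q q' \<longrightarrow>
                 (\<exists>A B. \<forall>t\<in>I. q t = superposition q\<^sub>e \<omega> w A B t)) \<and>
              (\<forall>A B. (\<exists>q'. motion_on Q UNIV (superposition q\<^sub>e \<omega> w A B) q') \<and>
                 (periodic (superposition q\<^sub>e \<omega> w A B) \<longleftrightarrow>
                    (\<forall>r\<in>excited A B. \<forall>s\<in>excited A B. \<omega> r / \<omega> s \<in> \<rat>))))))"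
proof (intro conjI allI impI)
  fix q\<^sub>e j assume "equilibrium_point Q (q\<^sub>e, 0)"
  then show "(\<Sum>\<alpha>\<in>UNIV. \<Sum>i\<in>UNIV. \<N> $ Inr \<alpha> $ j * \<N> $ Inr \<alpha> $ i / C $ \<alpha> * q\<^sub>e $ i) + const $ j = 0"
    by (simp add: components equilibrium_point_def lc_components_def vec_eq_iff)
next
  define M :: "real^'m^'m" where
    "M = (\<chi> j i. \<Sum>a\<in>UNIV. L $ a * \<N> $ Inl a $ j * \<N> $ Inl a $ i)"
  define K :: "real^'m^'m" where
    "K = (\<chi> j i. \<Sum>\<alpha>\<in>UNIV. \<N> $ Inr \<alpha> $ j * \<N> $ Inr \<alpha> $ i / C $ \<alpha>)"
  \<comment> \<open>The reciprocal capacitances act as the weights of the Gram matrix.\<close>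
  have K_gram: "K = (\<chi> j i. \<Sum>\<alpha>\<in>UNIV. (1 / C $ \<alpha>) * \<N> $ Inr \<alpha> $ j * \<N> $ Inr \<alpha> $ i)"
    by (simp add: K_def)
  have M_mult: "(M *v x) $ j = (\<Sum>a\<in>UNIV. L $ a * \<N> $ Inl a $ j * (\<N> $ Inl a \<bullet> x))" for x j
    unfolding M_def by (rule mult_weighted_gram)
  have K_mult: "(K *v x) $ j = (\<Sum>\<alpha>\<in>UNIV. 1 / C $ \<alpha> * \<N> $ Inr \<alpha> $ j * (\<N> $ Inr \<alpha> \<bullet> x))" for x j
    unfolding K_gram by (rule mult_weighted_gram)
  have lc: "lc_components L C \<N> d q q' q'' = M *v q'' + K *v q + d" for d q q' q''
    by (simp add: vec_eq_iff lc_components_def M_mult K_mult inner_vec_def sum_distrib_left mult_ac)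
  have K_inv: "invertible K"
    using det_C by (simp add: K_def invertible_det_nz)
  {
    fix d
    obtain K' where K': "K ** K' = mat 1" "K' ** K = mat 1"
      using K_inv by (auto simp: invertible_def)
    \<comment> \<open>The inverse \<open>K'\<close> of \<open>K\<close> solves the equilibrium
      system \<open>K *v q + d = 0\<close>.\<close>
    have "equilibrium_point (lc_components L C \<N> d) z \<longleftrightarrow> z = (- (K' *v d), 0)" for z
    proof -
      have "K *v q + d = 0 \<longleftrightarrow> q = - (K' *v d)" for q
      proof
        assume "K *v q + d = 0"
        then have "K' *v (K *v q) = K' *v (- d)" by (simp add: add_eq_0_iff2)
        then show "q = - (K' *v d)"
          by (simp add: matrix_vector_mul_assoc K' linear_neg[OF matrix_vector_mul_linear])
      next
        assume "q = - (K' *v d)"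
        then show "K *v q + d = 0"
          by (simp add: linear_neg[OF matrix_vector_mul_linear] matrix_vector_mul_assoc K')
      qed
      then show ?thesis by (cases z) (auto simp: equilibrium_point_def lc)
    qed
    then show "\<exists>!z. equilibrium_point (lc_components L C \<N> d) z" by simp
  }
  fix q\<^sub>e
  assume pos: "(\<forall>a. L $ a > 0) \<and> (\<forall>\<alpha>. C $ \<alpha> > 0)" and eq: "equilibrium_point Q (q\<^sub>e, 0)"
  interpret oscillator M K
  proof
    show "transpose M = M" "transpose K = K"
      unfolding K_gram M_def by (rule transpose_weighted_gram)+
    show "x \<bullet> (M *v x) > 0" if "x \<noteq> 0" for x
      using pos det_L that by (intro weighted_gram_pos_def[OF M_def]) (auto simp: M_def)
    show "x \<bullet> (K *v x) > 0" if "x \<noteq> 0" for x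
      using pos det_C that by (intro weighted_gram_pos_def[OF K_gram]) (auto simp: K_def)
  qed
  have "K *v q\<^sub>e + const = 0"
    using eq by (simp add: equilibrium_point_def components lc)
  \<comment> \<open>The equilibrium equation trades the constant for a shift of the origin to
    \<open>q\<^sub>e\<close>.\<close>
  then have "const = - (K *v q\<^sub>e)" by (simp add: add_eq_0_iff)
  then have Qb: "Q = balance q\<^sub>e"
    by (intro ext) (simp add: components lc balance_def matrix_vector_mult_diff_distrib)
  show "stable_equilibrium Q (q\<^sub>e, 0)" "center Q (q\<^sub>e, 0)"
    unfolding Qb by (rule stable_equilibrium_balance center_balance)+
  obtain w \<omega> where "normal_coordinates M K w \<omega>"
  proof (rule simultaneous_diagonalization)
    fix w :: "'m \<Rightarrow> real^'m" and \<omega> :: "'m \<Rightarrow> real"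
    assume "\<And>r s. w r \<bullet> (M *v w s) = of_bool (r = s)" and "\<And>r. \<omega> r > 0"
      "\<And>r. K *v w r = (\<omega> r)\<^sup>2 *\<^sub>R (M *v w r)"
    then have "normal_coordinates M K w \<omega>"
      by (simp add: normal_coordinates_def normal_coordinates_axioms_def oscillator_axioms)
    then show ?thesis by (rule that)
  qed
  then interpret normal_coordinates M K w \<omega> .
  show "\<exists>\<omega> w. (\<forall>r. \<omega> r > 0) \<and> inj w \<and> independent (range w) \<and>
      (\<forall>I q q'. is_interval I \<and> (\<exists>s\<in>I. \<exists>t\<in>I. s < t) \<and> motion_on Q I q q' \<longrightarrow>
         (\<exists>A B. \<forall>t\<in>I. q t = superposition q\<^sub>e \<omega> w A B t)) \<and>
      (\<forall>A B. (\<exists>q'. motion_on Q UNIV (superposition q\<^sub>e \<omega> w A B) q') \<and>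
         (periodic (superposition q\<^sub>e \<omega> w A B) \<longleftrightarrow>
            (\<forall>r\<in>excited A B. \<forall>s\<in>excited A B. \<omega> r / \<omega> s \<in> \<rat>)))"
  proof (rule exI[of _ \<omega>], rule exI[of _ w], intro conjI allI impI)
    show "periodic (superposition q\<^sub>e \<omega> w A B) \<longleftrightarrow>
        (\<forall>r\<in>excited A B. \<forall>s\<in>excited A B. \<omega> r / \<omega> s \<in> \<rat>)" for A B
      using periodic_superposition_imp_commensurable commensurable_imp_periodic_superposition by blast
  qed (use \<omega>_pos inj_w independent_w motion_is_superposition superposition_is_motion Qb in auto)
qed

end
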